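(* Let $n,m\ge 1$, let $(u_i)_{i=1}^m$ be a sequence of Euclidean unit vectors in $\mathbb{R}^n$ and let $(c_i)_{i=1}^m$ be a sequence of positive real numbers satisfying (a) $\sum_{i=1}^m c_i u_i = 0$ and (b) $\sum_{i=1}^m c_i\, u_i\otimes u_i = I_n$. Let $K=\{x\in\mathbb{R}^n : \langle x,u_i\rangle\le 1 \text{ for all } 1\le i\le m\}$. Then $K$ contains a unique ellipsoid of maximal volume, namely the Euclidean unit ball $B_2^n$. That is, $B_2^n\subset K$, and every ellipsoid $\mathcal{E}\subset K$ with $\mathcal{E}\neq B_2^n$ has volume strictly smaller than that of $B_2^n$.
   Context: $\langle\cdot,\cdot\rangle$ and $\|\cdot\|$ are the standard inner product and Euclidean norm on $\mathbb{R}^n$, $B_2^n=\{x\in\mathbb{R}^n:\|x\|\le 1\}$, and $I_n$ is the identity operator on $\mathbb{R}^n$. For $u\in\mathbb{R}^n$, $u\otimes u$ denotes the operator $x\mapsto\langle u,x\rangle u$; thus (b) says $\sum_i c_i\langle u_i,x\rangle\langle u_i,y\rangle=\langle x,y\rangle$ for all $x,y\in\mathbb{R}^n$. An ellipsoid in $\mathbb{R}^n$ is a solid, non-degenerate, not necessarily origin-centred one: a set of the form $\{x\in\mathbb{R}^n:\sum_{j=1}^n\alpha_j^{-2}\langle x-y,v_j\rangle^2\le 1\}$ for some $y\in\mathbb{R}^n$, some orthonormal basis $(v_j)_{j=1}^n$ of $\mathbb{R}^n$ and some positive numbers $(\alpha_j)_{j=1}^n$. *)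

theory Defs
  imports "HOL-Analysis.Analysis"
begin

definition rank_one :: "real ^ 'n \<Rightarrow> real ^ 'n \<Rightarrow> real ^ 'n" where
  "rank_one u = (\<lambda>x. (u \<bullet> x) *\<^sub>R u)"

definition orthonormal_basis :: "('n \<Rightarrow> real ^ 'n) \<Rightarrow> bool" where
  "orthonormal_basis v \<longleftrightarrow>
     (\<forall>j. norm (v j) = 1) \<and>
     (\<forall>j k. j \<noteq> k \<longrightarrow> orthogonal (v j) (v k)) \<and>
     span (range v) = UNIV"

definition ellipsoid :: "(real ^ 'n) set \<Rightarrow> bool" where
  "ellipsoid E \<longleftrightarrow>
     (\<exists>(y :: real ^ 'n) (v :: 'n \<Rightarrow> real ^ 'n) (\<alpha> :: 'n \<Rightarrow> real).
        orthonormal_basis v \<and> (\<forall>j. \<alpha> j > 0) \<and>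
        E = {x. (\<Sum>j\<in>UNIV. ((x - y) \<bullet> v j)\<^sup>2 / (\<alpha> j)\<^sup>2) \<le> 1})"

text \<open>Every ellipsoid is compact, so its real-valued Lebesgue measure is its true (finite) volume.\<close>

definition max_volume_ellipsoid :: "(real ^ 'n) set \<Rightarrow> (real ^ 'n) set \<Rightarrow> bool" where
  "max_volume_ellipsoid K E \<longleftrightarrow>
     ellipsoid E \<and> E \<subseteq> K \<and>
     (\<forall>E'. ellipsoid E' \<and> E' \<subseteq> K \<longrightarrow> measure lebesgue E' \<le> measure lebesgue E)"

end

theory Submission
  imports Defs
begin

text \<open>
  Testing \<open>E \<subseteq> K\<close>, where \<open>E\<close> has centre \<open>y\<close>, axes \<open>v\<^sub>j\<close> and semi-axes \<open>\<alpha>\<^sub>j\<close>, at the points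
  \<open>y + \<Sum>\<^sub>j \<alpha>\<^sub>j \<langle>v\<^sub>j, u\<^sub>i\<rangle> v\<^sub>j\<close> of \<open>E\<close> gives \<open>\<langle>y, u\<^sub>i\<rangle> + \<Sum>\<^sub>j \<alpha>\<^sub>j \<langle>v\<^sub>j, u\<^sub>i\<rangle>\<^sup>2 \<le> 1\<close>.
  Averaging with the weights \<open>c\<^sub>i\<close> removes \<open>y\<close> and leaves \<open>\<Sum>\<^sub>j \<alpha>\<^sub>j \<le> \<Sum>\<^sub>i c\<^sub>i = n\<close>, so by AM-GM
  the volume ratio \<open>\<Prod>\<^sub>j \<alpha>\<^sub>j\<close> is below \<open>1\<close> unless all \<open>\<alpha>\<^sub>j\<close> equal \<open>1\<close>. In that case
  \<open>\<langle>y, u\<^sub>i\<rangle> \<le> 0\<close> for all \<open>i\<close>, which together with \<open>\<Sum>\<^sub>i c\<^sub>i u\<^sub>i = 0\<close> forces \<open>y = 0\<close>.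
\<close>

section \<open>Volume of orthogonal images\<close>

text \<open>
  The library proves \<open>measure_orthogonal_image\<close> only for index types of class \<open>wellorder\<close>.
  Vitali covering avoids this restriction: orthogonal maps send balls to balls of equal radius.
\<close>

lemma emeasure_orthogonal_image_ge:
  fixes f :: "'a::euclidean_space \<Rightarrow> 'a"
  assumes f: "orthogonal_transformation f" and S: "open S"
  shows "emeasure lebesgue S \<le> emeasure lebesgue (f ` S)"
proof -
  \<comment> \<open>Index set of the Vitali cover: centre and radius of every closed ball of
    positive radius inside \<open>S\<close>.\<close>
  define K where "K = {(a, r). 0 < r \<and> cball a r \<subseteq> S}"
  define B where "B = (\<lambda>i::'a \<times> real. cball (fst i) (snd i))"
  have inj: "inj f" and lin: "linear f" and surj: "surj f"
    using f orthogonal_transformation_inj orthogonal_transformation_linear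
      orthogonal_transformation_surj by blast+
  have pos: "0 < snd i" if "i \<in> K" for i
    using that by (auto simp: K_def)
  have covers: "\<exists>i. i \<in> K \<and> x \<in> cball (fst i) (snd i) \<and> snd i < d" if x: "x \<in> S" and d: "0 < d" for x d
  proof -
    obtain e where e: "e > 0" "cball x e \<subseteq> S"
      using S x open_contains_cball by blast
    have "cball x (min e (d/2)) \<subseteq> S"
      using e(2) by (meson cball_min_Int dual_order.trans min.cobounded1 subset_cball)
    then have "(x, min e (d/2)) \<in> K"
      using e(1) d by (simp add: K_def)
    moreover have "snd (x, min e (d/2)) < d" "x \<in> cball (fst (x, min e (d/2))) (snd (x, min e (d/2)))"
      using d e(1) by auto
    ultimately show ?thesis by blast
  qed
  obtain C where C: "countable C" "C \<subseteq> K"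
     "pairwise (\<lambda>i j. disjnt (cball (fst i) (snd i)) (cball (fst j) (snd j))) C"
     "negligible (S - (\<Union>i\<in>C. cball (fst i) (snd i)))"
    by (rule Vitali_covering_theorem_cballs[of K snd S fst, OF pos covers])
  have disj: "disjoint_family_on B C"
    using C(3) by (auto simp: disjoint_family_on_def pairwise_def disjnt_def B_def)
  have fB: "f ` B i = cball (f (fst i)) (snd i)" for i
    by (simp add: B_def image_orthogonal_transformation_cball f)
  have disjf: "disjoint_family_on (\<lambda>i. f ` B i) C"
    using disj inj by (simp add: disjoint_family_on_def flip: image_Int)
  have same: "emeasure lebesgue (f ` B i) = emeasure lebesgue (B i)" if "i \<in> C" for i
  proof -
    have "snd i \<ge> 0" using that C(2) pos by (meson less_imp_le subsetD)
    then show ?thesis unfolding fB unfolding B_def by (simp add: emeasure_cball)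
  qed
  have sub: "(\<Union>i\<in>C. B i) \<subseteq> S"
    using C(2) by (force simp: K_def B_def)
  have openf: "open (f ` S)"
    using S lin surj by (simp add: open_surjective_linear_image)
  have meas: "(\<Union>i\<in>C. B i) \<in> sets lebesgue"
    using C(1) by (intro sets.countable_UN') (auto simp: B_def)
  have null: "S - (\<Union>i\<in>C. B i) \<in> null_sets lebesgue"
    using C(4) by (simp add: B_def negligible_iff_null_sets)
  have "emeasure lebesgue S = emeasure lebesgue ((\<Union>i\<in>C. B i) \<union> (S - (\<Union>i\<in>C. B i)))"
    using sub by (simp add: Un_absorb1)
  also have "\<dots> = emeasure lebesgue (\<Union>i\<in>C. B i)"
    by (rule emeasure_Un_null_set[OF meas null])
  also have "\<dots> = (\<integral>\<^sup>+i. emeasure lebesgue (B i) \<partial>count_space C)"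
    using C(1) disj by (intro emeasure_UN_countable) (auto simp: B_def)
  also have "\<dots> = (\<integral>\<^sup>+i. emeasure lebesgue (f ` B i) \<partial>count_space C)"
    by (intro nn_integral_cong) (simp add: same)
  also have "\<dots> = emeasure lebesgue (\<Union>i\<in>C. f ` B i)"
    using C(1) disjf by (intro emeasure_UN_countable[symmetric]) (auto simp: fB)
  \<comment> \<open>The image of the leftover null set is dropped here, so only an inequality
    results.\<close>
  also have "\<dots> \<le> emeasure lebesgue (f ` S)"
    using sub openf by (intro emeasure_mono) (auto simp: borel_open)
  finally show ?thesis .
qed

text \<open>The inverse of an orthogonal map is again orthogonal, so the one-sided bound applied to
  it gives the reverse inequality.\<close>

lemma emeasure_orthogonal_image_open:
  fixes f :: "'a::euclidean_space \<Rightarrow> 'a"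
  assumes f: "orthogonal_transformation f" and S: "open S"
  shows "emeasure lebesgue (f ` S) = emeasure lebesgue S"
proof (rule antisym)
  have inj: "inj f" and lin: "linear f" and surj: "surj f"
    using f orthogonal_transformation_inj orthogonal_transformation_linear
      orthogonal_transformation_surj by blast+
  have "emeasure lebesgue (f ` S) \<le> emeasure lebesgue (inv f ` f ` S)"
    using S lin surj f orthogonal_transformation_inv open_surjective_linear_image
    by (intro emeasure_orthogonal_image_ge) blast+
  also have "inv f ` f ` S = S"
    using inj by (simp add: image_comp)
  finally show "emeasure lebesgue (f ` S) \<le> emeasure lebesgue S" .
qed (rule emeasure_orthogonal_image_ge[OF f S])

text \<open>The frontier of a convex set is negligible, and \<open>f\<close>, being linear and
  injective, commutes with \<open>interior\<close>; this reduces the claim to open sets.\<close>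

lemma measure_orthogonal_image_convex:
  fixes f :: "'a::euclidean_space \<Rightarrow> 'a"
  assumes f: "orthogonal_transformation f" and S: "convex S" "bounded S"
  shows "measure lebesgue (f ` S) = measure lebesgue S"
proof -
  have inj: "inj f" and lin: "linear f"
    using f orthogonal_transformation_inj orthogonal_transformation_linear by blast+
  have "measure lebesgue (f ` S) = measure lebesgue (interior (f ` S))"
    using S lin by (intro measure_interior[symmetric] negligible_convex_frontier
        convex_linear_image bounded_linear_image) (simp_all add: linear_conv_bounded_linear)
  also have "\<dots> = measure lebesgue (f ` interior S)"
    by (simp add: interior_injective_linear_image lin inj)
  also have "\<dots> = measure lebesgue (interior S)"
    by (simp add: measure_def emeasure_orthogonal_image_open f)
  also have "\<dots> = measure lebesgue S"
    using S by (intro measure_interior negligible_convex_frontier)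
  finally show ?thesis .
qed

section \<open>Ellipsoids\<close>

context
  fixes v :: "'n::finite \<Rightarrow> real ^ 'n"
  assumes v: "orthonormal_basis v"
begin

lemma orthonormal_basis_inner: "v j \<bullet> v k = (if j = k then 1 else 0)"
  using v by (auto simp: orthonormal_basis_def orthogonal_def dot_square_norm)

lemma orthonormal_basis_inner_sum: "(\<Sum>k\<in>UNIV. a k *\<^sub>R v k) \<bullet> v j = a j"
  by (simp add: inner_sum_left orthonormal_basis_inner if_distrib cong: if_cong)

text \<open>This isometry takes the coordinate axes to \<open>v\<close>. Its surjectivity yields the
  expansion in \<open>v\<close>, and its invariance of volume handles tilted ellipsoids.\<close>

lemma orthogonal_transformation_basis: "orthogonal_transformation (\<lambda>x. \<Sum>j\<in>UNIV. x $ j *\<^sub>R v j)"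
  unfolding orthogonal_transformation_def
proof (intro conjI allI)
  show "linear (\<lambda>x. \<Sum>j\<in>UNIV. x $ j *\<^sub>R v j)"
    by (intro linearI) (simp_all add: scaleR_left_distrib sum.distrib scaleR_right.sum)
  show "(\<Sum>j\<in>UNIV. x $ j *\<^sub>R v j) \<bullet> (\<Sum>j\<in>UNIV. y $ j *\<^sub>R v j) = x \<bullet> y" for x y
    unfolding inner_sum_right inner_scaleR_right orthonormal_basis_inner_sum
    by (simp add: inner_vec_def mult.commute)
qed

lemma orthonormal_basis_expansion: "x = (\<Sum>j\<in>UNIV. (x \<bullet> v j) *\<^sub>R v j)"
proof -
  obtain w where w: "x = (\<Sum>j\<in>UNIV. w $ j *\<^sub>R v j)"
    using surjD[OF orthogonal_transformation_surj[OF orthogonal_transformation_basis], of x] by blast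
  show ?thesis
    unfolding w orthonormal_basis_inner_sum ..
qed

lemma orthonormal_basis_parseval: "(\<Sum>j\<in>UNIV. (x \<bullet> v j)\<^sup>2) = x \<bullet> x"
proof -
  have "x \<bullet> x = x \<bullet> (\<Sum>j\<in>UNIV. (x \<bullet> v j) *\<^sub>R v j)"
    using orthonormal_basis_expansion by (rule arg_cong)
  then show ?thesis
    by (simp add: inner_sum_right power2_eq_square)
qed

text \<open>Prepares the volume computation: of the stretch, the isometry and the translation
  applied to the unit ball, only the stretch changes volume.\<close>

lemma ellipsoid_eq_image:
  assumes \<alpha>: "\<And>j. \<alpha> j > 0"
  shows "{x. (\<Sum>j\<in>UNIV. ((x - y) \<bullet> v j)\<^sup>2 / (\<alpha> j)\<^sup>2) \<le> 1} =
    (+) y ` (\<lambda>x. \<Sum>j\<in>UNIV. x $ j *\<^sub>R v j) ` (\<lambda>x. \<chi> j. \<alpha> j * x $ j) ` cball 0 1"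
    (is "?E = (+) y ` ?f ` ?g ` _")
proof (intro equalityI subsetI)
  have cball: "z \<in> cball 0 1 \<longleftrightarrow> (\<Sum>j\<in>UNIV. (z $ j)\<^sup>2) \<le> 1" for z :: "real ^ 'n"
    by (simp add: norm_vec_def L2_set_def)
  have \<alpha>0: "\<alpha> j \<noteq> 0" for j
    using \<alpha>[of j] by simp
  fix x
  {
    assume x: "x \<in> ?E"
    \<comment> \<open>Undoes the three maps in turn: subtract the centre, take coordinates in
      \<open>v\<close>, divide by the semi-axes.\<close>
    define z :: "real ^ 'n" where "z = (\<chi> j. ((x - y) \<bullet> v j) / \<alpha> j)"
    have "z \<in> cball 0 1"
      using x unfolding cball by (simp add: z_def power_divide)
    moreover have "x = y + ?f (?g z)"
      using orthonormal_basis_expansion[of "x - y", symmetric] \<alpha>0 by (simp add: z_def)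
    ultimately show "x \<in> (+) y ` ?f ` ?g ` cball 0 1"
      by blast
  next
    assume "x \<in> (+) y ` ?f ` ?g ` cball 0 1"
    then obtain z where z: "z \<in> cball 0 1" and x: "x = y + ?f (?g z)"
      by blast
    have "(x - y) \<bullet> v j = \<alpha> j * z $ j" for j
      by (simp add: x orthonormal_basis_inner_sum)
    then show "x \<in> ?E"
      using z \<alpha>0 unfolding cball by (simp add: power_mult_distrib)
  }
qed

lemma measure_ellipsoid:
  assumes \<alpha>: "\<And>j. \<alpha> j > 0"
  shows "measure lebesgue {x. (\<Sum>j\<in>UNIV. ((x - y) \<bullet> v j)\<^sup>2 / (\<alpha> j)\<^sup>2) \<le> 1} =
    prod \<alpha> UNIV * measure lebesgue (cball 0 1 :: (real ^ 'n) set)"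
proof -
  let ?g = "\<lambda>x::real^'n. \<chi> j. \<alpha> j * x $ j"
  have "linear ?g"
    by (intro linearI) (simp_all add: vec_eq_iff algebra_simps)
  then have "convex (?g ` cball 0 1)" "bounded (?g ` cball 0 1)"
    by (simp_all add: convex_linear_image bounded_linear_image linear_conv_bounded_linear)
  moreover have "prod \<alpha> UNIV \<ge> 0"
    using \<alpha> by (intro prod_nonneg) (simp add: less_imp_le)
  ultimately show ?thesis
    unfolding ellipsoid_eq_image[OF \<alpha>] measure_translation
    using measure_orthogonal_image_convex[OF orthogonal_transformation_basis, of "?g ` cball 0 1"]
      measure_stretch[OF lmeasurable_cball, of \<alpha> 0 1] by (simp only: abs_of_nonneg)
qed

text \<open>Parseval collapses the sum to a squared distance. The divisor \<open>1\<^sup>2\<close>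
  keeps the shape of the definition of \<open>ellipsoid\<close>.\<close>

lemma ellipsoid_unit_axes: "{x. (\<Sum>j\<in>UNIV. ((x - y) \<bullet> v j)\<^sup>2 / 1\<^sup>2) \<le> 1} = cball y 1"
proof (rule set_eqI)
  fix x
  have "(\<Sum>j\<in>UNIV. ((x - y) \<bullet> v j)\<^sup>2 / 1\<^sup>2) = (dist y x)\<^sup>2"
    by (simp add: orthonormal_basis_parseval dot_square_norm dist_norm norm_minus_commute)
  then show "x \<in> {x. (\<Sum>j\<in>UNIV. ((x - y) \<bullet> v j)\<^sup>2 / 1\<^sup>2) \<le> 1} \<longleftrightarrow> x \<in> cball y 1"
    by (simp add: abs_square_le_1)
qed

end

lemma ellipsoid_cball: "ellipsoid (cball y 1 :: (real ^ 'n::finite) set)"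
proof -
  define v :: "'n \<Rightarrow> real ^ 'n" where "v = (\<lambda>j. axis j 1)"
  have "range v = Basis"
    by (auto simp: v_def Basis_vec_def)
  then have "orthonormal_basis v"
    by (auto simp: orthonormal_basis_def v_def orthogonal_def inner_axis_axis)
  then show ?thesis
    unfolding ellipsoid_def using ellipsoid_unit_axes[of v y]
    by (intro exI[of _ y] exI[of _ v] exI[of _ "\<lambda>_. 1"]) auto
qed

text \<open>AM-GM in logarithmic form: sum \<open>ln t \<le> t - 1\<close>, where equality holds
  only at \<open>t = 1\<close>.\<close>

lemma prod_less_one_if_sum_le_card:
  fixes a :: "'a \<Rightarrow> real"
  assumes "finite A" and pos: "\<And>i. i \<in> A \<Longrightarrow> a i > 0"
    and le: "sum a A \<le> card A" and ne: "\<exists>i\<in>A. a i \<noteq> 1"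
  shows "prod a A < 1"
proof -
  have "(\<Sum>i\<in>A. ln (a i)) < (\<Sum>i\<in>A. a i - 1)"
  proof (rule sum_strict_mono_ex1[OF \<open>finite A\<close>])
    show "\<forall>i\<in>A. ln (a i) \<le> a i - 1"
      using pos ln_le_minus_one by blast
    show "\<exists>i\<in>A. ln (a i) < a i - 1"
      using pos ne ln_le_minus_one ln_eq_minus_one by (meson order_le_less)
  qed
  also have "\<dots> \<le> 0"
    using le by (simp add: sum_subtractf)
  finally have "ln (prod a A) < 0"
    using pos \<open>finite A\<close> by (subst ln_prod) (auto simp: less_imp_neq[symmetric])
  then show ?thesis
    using pos by (simp add: prod_pos)
qed

section \<open>John's decomposition of the identity\<close>

text \<open>Bilinear form of the operator identity, used below on the diagonal: at each axis
  \<open>v j\<close> and at the centre \<open>y\<close>.\<close>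

lemma decomposition_inner:
  assumes "(\<lambda>x. \<Sum>i\<in>I. c i *\<^sub>R rank_one (u i) x) = id"
  shows "(\<Sum>i\<in>I. c i * ((u i \<bullet> x) * (u i \<bullet> y))) = x \<bullet> y"
proof -
  have "x \<bullet> y = (\<Sum>i\<in>I. c i *\<^sub>R rank_one (u i) x) \<bullet> y"
    using fun_cong[OF assms, of x] by simp
  then show ?thesis
    by (simp add: rank_one_def inner_sum_left mult.assoc)
qed

lemma measure_ellipsoid_in_polytope_less:
  fixes u :: "nat \<Rightarrow> real ^ 'n::finite"
  assumes "finite I" and unit: "\<And>i. i \<in> I \<Longrightarrow> norm (u i) = 1"
    and c: "\<And>i. i \<in> I \<Longrightarrow> c i > 0"
    and centred: "(\<Sum>i\<in>I. c i *\<^sub>R u i) = 0"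
    and decomp: "(\<lambda>x. \<Sum>i\<in>I. c i *\<^sub>R rank_one (u i) x) = id"
    and E: "ellipsoid E" "E \<subseteq> {x. \<forall>i\<in>I. x \<bullet> u i \<le> 1}" "E \<noteq> cball 0 1"
  shows "measure lebesgue E < measure lebesgue (cball 0 1 :: (real ^ 'n) set)"
proof -
  obtain y v \<alpha> where v: "orthonormal_basis v" and \<alpha>: "\<And>j. \<alpha> j > 0"
    and Eq: "E = {x. (\<Sum>j\<in>UNIV. ((x - y) \<bullet> v j)\<^sup>2 / (\<alpha> j)\<^sup>2) \<le> 1}"
    using E(1) unfolding ellipsoid_def by blast
  have \<alpha>0: "\<alpha> j \<noteq> 0" for j
    using \<alpha>[of j] by simp
  have support: "y \<bullet> u i + (\<Sum>j\<in>UNIV. \<alpha> j * (u i \<bullet> v j)\<^sup>2) \<le> 1" if i: "i \<in> I" for i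
  proof -
    \<comment> \<open>The affine map carrying the unit ball onto \<open>E\<close>, with symmetric
      linear part, sends \<open>u i\<close> to this point.\<close>
    define x where "x = y + (\<Sum>j\<in>UNIV. (\<alpha> j * (u i \<bullet> v j)) *\<^sub>R v j)"
    have "(x - y) \<bullet> v j = \<alpha> j * (u i \<bullet> v j)" for j
      by (simp add: x_def orthonormal_basis_inner_sum[OF v])
    then have "x \<in> E"
      using unit[OF i] \<alpha>0
      by (simp add: Eq power_mult_distrib orthonormal_basis_parseval[OF v] dot_square_norm)
    then have "x \<bullet> u i \<le> 1"
      using E(2) i by blast
    then show ?thesis
      by (simp add: x_def inner_add_left inner_add_right inner_sum_left inner_sum_right
          power2_eq_square inner_commute mult.assoc)
  qed
  have moment: "(\<Sum>i\<in>I. c i * (u i \<bullet> v j)\<^sup>2) = 1" for j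
    using decomposition_inner[OF decomp, of "v j" "v j"]
    by (simp add: power2_eq_square orthonormal_basis_inner[OF v])
  have mean: "(\<Sum>i\<in>I. c i * (y \<bullet> u i)) = 0"
    using arg_cong[OF centred, of "\<lambda>x. y \<bullet> x"] by (simp add: inner_sum_right)
  \<comment> \<open>Trace of the decomposition: each unit vector contributes its weight, each axis
    contributes 1.\<close>
  have "sum c I = (\<Sum>i\<in>I. c i * (\<Sum>j\<in>UNIV. (u i \<bullet> v j)\<^sup>2))"
    using unit by (intro sum.cong) (simp_all add: orthonormal_basis_parseval[OF v] dot_square_norm)
  also have "\<dots> = (\<Sum>j\<in>UNIV. \<Sum>i\<in>I. c i * (u i \<bullet> v j)\<^sup>2)"
    unfolding sum_distrib_left by (rule sum.swap)
  finally have sum_c: "sum c I = CARD('n)"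
    by (simp add: moment)
  have "sum \<alpha> UNIV = (\<Sum>j\<in>UNIV. \<alpha> j * (\<Sum>i\<in>I. c i * (u i \<bullet> v j)\<^sup>2))"
    by (simp add: moment)
  also have "\<dots> = (\<Sum>i\<in>I. \<Sum>j\<in>UNIV. c i * (\<alpha> j * (u i \<bullet> v j)\<^sup>2))"
    unfolding sum_distrib_left by (subst sum.swap) (simp add: mult_ac)
  \<comment> \<open>The centre can be inserted freely because its weighted mean against the
    \<open>u i\<close> vanishes; this makes \<open>support\<close> applicable.\<close>
  also have "\<dots> = (\<Sum>i\<in>I. c i * (y \<bullet> u i + (\<Sum>j\<in>UNIV. \<alpha> j * (u i \<bullet> v j)\<^sup>2)))"
    by (simp add: distrib_left sum.distrib mean sum_distrib_left)
  also have "\<dots> \<le> (\<Sum>i\<in>I. c i * 1)"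
    using c support by (intro sum_mono mult_left_mono) (auto simp: less_imp_le)
  finally have sum_\<alpha>: "sum \<alpha> UNIV \<le> CARD('n)"
    by (simp add: sum_c)
  have "\<exists>j. \<alpha> j \<noteq> 1"
  proof (rule ccontr)
    assume "\<nexists>j. \<alpha> j \<noteq> 1"
    then have one: "\<alpha> j = 1" for j
      by blast
    have "y \<bullet> u i \<le> 0" if "i \<in> I" for i
      using support[OF that] unit[OF that]
      by (simp add: one orthonormal_basis_parseval[OF v] dot_square_norm)
    then have "\<forall>i\<in>I. 0 \<le> - (c i * (y \<bullet> u i))"
      using c by (simp add: mult_nonneg_nonpos less_imp_le)
    moreover have "(\<Sum>i\<in>I. - (c i * (y \<bullet> u i))) = 0"
      using mean by (simp add: sum_negf)
    \<comment> \<open>Nonnegative terms with sum zero vanish individually.\<close>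
    ultimately have "\<forall>i\<in>I. - (c i * (y \<bullet> u i)) = 0"
      using sum_nonneg_eq_0_iff[OF \<open>finite I\<close>, of "\<lambda>i. - (c i * (y \<bullet> u i))"] by simp
    then have "\<forall>i\<in>I. u i \<bullet> y = 0"
      using c by (force simp: inner_commute)
    then have "y \<bullet> y = 0"
      using decomposition_inner[OF decomp, of y y] by simp
    then have "E = cball 0 1"
      using ellipsoid_unit_axes[OF v, of y] by (simp add: Eq one)
    with E(3) show False ..
  qed
  then have "prod \<alpha> UNIV < 1"
    using \<alpha> sum_\<alpha> by (intro prod_less_one_if_sum_le_card) auto
  then show ?thesis
    \<comment> \<open>The strict inequality survives scaling since the unit ball has positive
      volume.\<close>
    unfolding Eq measure_ellipsoid[OF v \<alpha>]
    using content_cball_gt_0_iff[of "0 :: real ^ 'n" 1] by simp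
qed

theorem proposition1:
  fixes m :: nat
    and u :: "nat \<Rightarrow> real ^ 'n"
    and c :: "nat \<Rightarrow> real"
    and K :: "(real ^ 'n) set"
  assumes "m \<ge> 1"
    and "\<And>i. i \<in> {1..m} \<Longrightarrow> norm (u i) = 1"
    and "\<And>i. i \<in> {1..m} \<Longrightarrow> c i > 0"
    and "(\<Sum>i=1..m. c i *\<^sub>R u i) = 0"
    and "(\<lambda>x. \<Sum>i=1..m. c i *\<^sub>R rank_one (u i) x) = id"
    and "K = {x. \<forall>i\<in>{1..m}. x \<bullet> u i \<le> 1}"
  shows "(\<forall>E. max_volume_ellipsoid K E \<longleftrightarrow> E = cball 0 1) \<and>
    cball 0 1 \<subseteq> K \<and>
    (\<forall>E. ellipsoid E \<and> E \<subseteq> K \<and> E \<noteq> cball 0 1 \<longrightarrow>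
       measure lebesgue E < measure lebesgue (cball 0 1 :: (real ^ 'n) set))"
proof -
  let ?B = "cball 0 1 :: (real ^ 'n) set"
  have BK: "?B \<subseteq> K"
  proof
    fix x assume "x \<in> ?B"
    then have "x \<bullet> u i \<le> 1" if "i \<in> {1..m}" for i
      using norm_cauchy_schwarz[of x "u i"] assms(2)[OF that] by simp
    then show "x \<in> K"
      by (simp add: assms(6))
  qed
  have less: "measure lebesgue E < measure lebesgue ?B"
    if "ellipsoid E" "E \<subseteq> K" "E \<noteq> ?B" for E
    using measure_ellipsoid_in_polytope_less[OF finite_atLeastAtMost assms(2-5)] that assms(6) by blast
  \<comment> \<open>Any other maximiser would be strictly beaten by the ball, itself an ellipsoid in
    \<open>K\<close>.\<close>
  then have "max_volume_ellipsoid K E \<longleftrightarrow> E = ?B" for E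
    using BK ellipsoid_cball[of 0] unfolding max_volume_ellipsoid_def
    by (metis less_imp_le linorder_not_le order_refl)
  with BK less show ?thesis
    by blast
qed

end
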